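(* Let $A$ be a finite set, $n\ge3$, and let $\rho\subseteq A^n$ be preserved by a WNU, with pattern equal to the equivalence relation with classes $\{1,2\},\{3\},\dots,\{n\}$. Then $\rho$ is a key relation if and only if there exist $(a_1,\dots,a_n)\in A^n\setminus\rho$ and $b_1,\dots,b_n\in A$ with $b_i\neq a_i$ for all $i$ such that $$(\{a_1,b_1\}\times\dots\times\{a_n,b_n\})\setminus\{(a_1,a_2,a_3,\dots,a_n),(b_1,b_2,a_3,\dots,a_n)\}\subseteq\rho.$$
   Context: A unary vector-function is a tuple $\Psi=(\psi_1,\dots,\psi_n)$ of maps $\psi_i:A\to A$ acting coordinatewise; it preserves $\rho$ if $\Psi(\rho)\subseteq\rho$. $\rho\subseteq A^n$ is a key relation if there is $\beta\in A^n\setminus\rho$ (a key tuple) such that every $\alpha\in A^n\setminus\rho$ is mapped to $\beta$ by some unary vector-function preserving $\rho$. A WNU is an $m$-ary ($m\ge2$) operation $f$ on $A$ with $f(x,\dots,x)=x$ and $f(y,x,\dots,x)=f(x,y,x,\dots,x)=\dots=f(x,\dots,x,y)$; it preserves $\rho$ if applying it coordinatewise to any $m$ tuples of $\rho$ gives a tuple of $\rho$. The pattern of $\rho$: for $i\ne j$, $i\overset{\rho}{\sim}j$ iff there do NOT exist $c_1,\dots,c_n,d_i,d_j\in A$ with $(c_1,\dots,c_n)\notin\rho$ while the tuples obtained by replacing $c_i$ by $d_i$, replacing $c_j$ by $d_j$, and replacing both, all lie in $\rho$; and $i\overset{\rho}{\sim}i$ always. *)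

theory Defs
  imports Main
begin

text \<open>Tuples of A^n are lists of length n with entries in A; coordinates are
  indexed 0..n-1 (paper: 1..n).\<close>

definition tuples :: "'a set \<Rightarrow> nat \<Rightarrow> 'a list set" where
  "tuples A n = {xs. length xs = n \<and> set xs \<subseteq> A}"

definition apply_vf :: "(nat \<Rightarrow> 'a \<Rightarrow> 'a) \<Rightarrow> 'a list \<Rightarrow> 'a list" where
  "apply_vf psi xs = map (\<lambda>i. psi i (xs ! i)) [0..<length xs]"

definition vf_preserves :: "'a set \<Rightarrow> nat \<Rightarrow> (nat \<Rightarrow> 'a \<Rightarrow> 'a) \<Rightarrow> 'a list set \<Rightarrow> bool" where
  "vf_preserves A n psi rho \<longleftrightarrow>
     (\<forall>i<n. (\<forall>x\<in>A. psi i x \<in> A)) \<and> (\<forall>t\<in>rho. apply_vf psi t \<in> rho)"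

definition key_relation :: "'a set \<Rightarrow> nat \<Rightarrow> 'a list set \<Rightarrow> bool" where
  "key_relation A n rho \<longleftrightarrow>
     (\<exists>\<beta> \<in> tuples A n - rho. \<forall>\<alpha> \<in> tuples A n - rho.
        \<exists>psi. vf_preserves A n psi rho \<and> apply_vf psi \<alpha> = \<beta>)"

text \<open>An m-ary operation on A is a function on lists, used on lists of length m.\<close>
definition is_WNU :: "'a set \<Rightarrow> nat \<Rightarrow> ('a list \<Rightarrow> 'a) \<Rightarrow> bool" where
  "is_WNU A m f \<longleftrightarrow> m \<ge> 2 \<and>
     (\<forall>xs \<in> tuples A m. f xs \<in> A) \<and>
     (\<forall>x\<in>A. f (replicate m x) = x) \<and>
     (\<forall>x\<in>A. \<forall>y\<in>A. \<forall>i<m. \<forall>j<m.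
        f ((replicate m x)[i := y]) = f ((replicate m x)[j := y]))"

definition apply_op :: "nat \<Rightarrow> ('a list \<Rightarrow> 'a) \<Rightarrow> 'a list list \<Rightarrow> 'a list" where
  "apply_op n f ts = map (\<lambda>k. f (map (\<lambda>t. t ! k) ts)) [0..<n]"

definition op_preserves :: "nat \<Rightarrow> nat \<Rightarrow> ('a list \<Rightarrow> 'a) \<Rightarrow> 'a list set \<Rightarrow> bool" where
  "op_preserves n m f rho \<longleftrightarrow>
     (\<forall>ts. length ts = m \<and> set ts \<subseteq> rho \<longrightarrow> apply_op n f ts \<in> rho)"

definition preserved_by_WNU :: "'a set \<Rightarrow> nat \<Rightarrow> 'a list set \<Rightarrow> bool" where
  "preserved_by_WNU A n rho \<longleftrightarrow> (\<exists>m f. is_WNU A m f \<and> op_preserves n m f rho)"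

definition pattern :: "'a set \<Rightarrow> nat \<Rightarrow> 'a list set \<Rightarrow> nat \<Rightarrow> nat \<Rightarrow> bool" where
  "pattern A n rho i j \<longleftrightarrow> i = j \<or>
     \<not> (\<exists>c \<in> tuples A n. \<exists>di\<in>A. \<exists>dj\<in>A. c \<notin> rho \<and>
          c[i := di] \<in> rho \<and> c[j := dj] \<in> rho \<and> c[i := di, j := dj] \<in> rho)"

end

theory Submission
  imports Defs
begin

text \<open>
  A cube yields a key relation because \<open>1 \<sim> 2\<close> makes every section of \<open>\<rho>\<close> by the coordinates
  \<open>3, \<dots>, n\<close> a union of disjoint rectangles, so any \<open>\<alpha> \<notin> \<rho>\<close> can be folded onto the cube.

  For the converse all work happens at a key tuple \<open>\<beta>\<close>: whatever configuration in \<open>\<rho>\<close> surrounds some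
  tuple outside \<open>\<rho>\<close> can be transported to \<open>\<beta>\<close> by a vector-function. Thus inequivalent pairs of
  coordinates give two-dimensional cubes at \<open>\<beta>\<close>, and cubes on all facets of a set \<open>S\<close> of at
  least three coordinates, pairwise inequivalent, give a cube on \<open>S\<close>: apply the WNU to rows
  that are in \<open>\<rho>\<close> except for one row \<open>\<beta>\<close>. If the result always
  stays in \<open>\<rho>\<close>, filling up with as many rows of \<open>\<rho>\<close> as possible before entering \<open>\<rho>\<close> leaves two
  free rows, one of which carries a facet and the other the missing coordinate. Otherwise, walking
  through \<open>\<rho>\<close> by changing single coordinates, one crosses the boundary of \<open>\<rho>\<close> at some coordinate
  \<open>k\<close>; the crossing supplies coordinate \<open>k\<close> and the \<open>\<beta>\<close>-row the facet \<open>S - {k}\<close>.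
  Finally the facets omitting coordinate 1 and coordinate 2 are merged by the rectangle property.
\<close>

section \<open>Key tuples and WNUs in functional form\<close>

text \<open>Tuples become functions on all of \<open>nat\<close> whose values from \<open>n\<close>
  on are ignored, which is what \<open>R_cong\<close> expresses. Changing a coordinate is then
  function update, and a matrix of rows is a binary function.\<close>

locale key_wnu =
  fixes A :: "'a set" and n m :: nat and R :: "(nat \<Rightarrow> 'a) \<Rightarrow> bool"
    and \<beta> :: "nat \<Rightarrow> 'a" and g :: "(nat \<Rightarrow> 'a) \<Rightarrow> 'a"
  assumes R_cong: "R t \<Longrightarrow> (\<And>k. k < n \<Longrightarrow> t k = t' k) \<Longrightarrow> R t'"
    and R_A: "R t \<Longrightarrow> k < n \<Longrightarrow> t k \<in> A"
    and key_tuple_A: "k < n \<Longrightarrow> \<beta> k \<in> A"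
    and key_tuple_notin: "\<not> R \<beta>"
    and key: "(\<And>k. k < n \<Longrightarrow> \<alpha> k \<in> A) \<Longrightarrow> \<not> R \<alpha> \<Longrightarrow>
      \<exists>\<psi>. (\<forall>k<n. \<forall>v\<in>A. \<psi> k v \<in> A) \<and> (\<forall>t. R t \<longrightarrow> R (\<lambda>k. \<psi> k (t k))) \<and>
          (\<forall>k<n. \<psi> k (\<alpha> k) = \<beta> k)"
    and arity: "2 \<le> m"
    and g_A: "(\<And>j. j < m \<Longrightarrow> z j \<in> A) \<Longrightarrow> g z \<in> A"
    and g_cong: "(\<And>j. j < m \<Longrightarrow> z j = z' j) \<Longrightarrow> g z = g z'"
    and g_idem: "v \<in> A \<Longrightarrow> g (\<lambda>_. v) = v"
    and g_wnu: "v \<in> A \<Longrightarrow> w \<in> A \<Longrightarrow> i < m \<Longrightarrow> j < m \<Longrightarrow>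
      g ((\<lambda>_. v)(i := w)) = g ((\<lambda>_. v)(j := w))"
    and g_pres: "(\<And>j. j < m \<Longrightarrow> R (X j)) \<Longrightarrow> R (\<lambda>k. g (\<lambda>j. X j k))"
begin

definition sub :: "nat set \<Rightarrow> (nat \<Rightarrow> 'a) \<Rightarrow> nat \<Rightarrow> 'a" where
  "sub T b k = (if k \<in> T then b k else \<beta> k)"

text \<open>A cube on \<open>S\<close> with only the corner \<open>\<beta>\<close> missing. The
  singletons \<open>T = {k}\<close> force \<open>b k\<close> to differ from
  \<open>\<beta> k\<close>, because \<open>\<beta>\<close> is not in \<open>R\<close>.\<close>

definition good :: "nat set \<Rightarrow> bool" where
  "good S \<longleftrightarrow> (\<exists>b. \<forall>T. T \<subseteq> S \<longrightarrow> T \<noteq> {} \<longrightarrow> R (sub T b))"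

definition op :: "(nat \<Rightarrow> nat \<Rightarrow> 'a) \<Rightarrow> nat \<Rightarrow> 'a" where
  "op X k = g (\<lambda>j. X j k)"

lemma sub_empty [simp]: "sub {} b = \<beta>"
  by (auto simp: sub_def)

lemma goodI: "(\<And>T. T \<subseteq> S \<Longrightarrow> T \<noteq> {} \<Longrightarrow> R (sub T b)) \<Longrightarrow> good S"
  by (auto simp: good_def)

lemma R_op: "(\<And>j. j < m \<Longrightarrow> R (X j)) \<Longrightarrow> R (op X)"
  using g_pres[of X] by (simp add: op_def[abs_def])

lemma op_const: "k < n \<Longrightarrow> op (\<lambda>_. \<beta>) k = \<beta> k"
  by (simp add: op_def g_idem key_tuple_A)

lemma op_A: "k < n \<Longrightarrow> (\<And>j. j < m \<Longrightarrow> X j k \<in> A) \<Longrightarrow> op X k \<in> A"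
  by (simp add: op_def g_A)

section \<open>Cubes on pairwise inequivalent coordinates\<close>

text \<open>The value \<open>op X\<close> outside \<open>R\<close> is moved to
  \<open>\<beta>\<close>. The entry change in row \<open>q\<close> affects column \<open>k\<close>
  alone, while refilling row \<open>p\<close> with a corner of the facet affects only columns in
  \<open>S - {k}\<close>, so the two changes combine independently.\<close>

lemma good_cross:
  assumes rows: "\<And>j. j < m \<Longrightarrow> j \<noteq> p \<Longrightarrow> R (X j)" and Xp: "X p = \<beta>"
    and out: "\<not> R (op X)" and q: "q \<noteq> p" and k: "k \<in> S"
    and Rq: "R ((X q)(k := v))" and inn: "R (op (X(q := (X q)(k := v))))"
    and face: "good (S - {k})"
  shows "good S"
proof -
  define X' where "X' = X(q := (X q)(k := v))"
  have entry: "X j l \<in> A" if "j < m" "l < n" for j l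
    using that rows[of j] R_A[of "X j" l] key_tuple_A[of l] Xp by (cases "j = p") auto
  obtain \<psi> where \<psi>R: "\<And>x. R x \<Longrightarrow> R (\<lambda>l. \<psi> l (x l))"
    and \<psi>\<beta>: "\<And>l. l < n \<Longrightarrow> \<psi> l (op X l) = \<beta> l"
    using key[of "op X", OF op_A[of _ X] out] entry by blast
  obtain b where b: "\<And>T. T \<subseteq> S - {k} \<Longrightarrow> T \<noteq> {} \<Longrightarrow> R (sub T b)"
    using face unfolding good_def by blast
  \<comment> \<open>Coordinate \<open>k\<close> is read off after the crossing, the others off the
    matrix whose row \<open>p\<close> is \<open>b\<close>.\<close>
  define c where "c l = (if l = k then \<psi> k (op X' k) else \<psi> l (op (X(p := b)) l))" for l
  have colp: "op (X(p := y)) l = op X l" if "y l = \<beta> l" for y l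
    using Xp that by (auto simp: op_def intro!: g_cong)
  have colb: "op (X(p := y)) l = op (X(p := b)) l" if "y l = b l" for y l
    using that by (auto simp: op_def intro!: g_cong)
  have colp': "op (X'(p := y)) l = op X' l" if "y l = \<beta> l" for y l
    using Xp that q by (auto simp: op_def X'_def intro!: g_cong)
  have colq: "op (X'(p := y)) l = op (X(p := y)) l" if "l \<noteq> k" for y l
    using that by (auto simp: op_def X'_def intro!: g_cong)
  show ?thesis
  proof (rule goodI)
    fix T assume T: "T \<subseteq> S" "T \<noteq> {}"
    show "R (sub T c)"
    proof (cases "k \<in> T")
      case False
      have "R (op (X(p := sub T b)))"
        using rows b[of T] T False by (intro R_op) auto
      from \<psi>R[OF this] show ?thesis
      proof (rule R_cong)
        fix l assume "l < n"
        then show "\<psi> l (op (X(p := sub T b)) l) = sub T c l"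
          using False \<psi>\<beta> colp[of "sub T b" l] colb[of "sub T b" l] by (auto simp: sub_def c_def)
      qed
    next
      case True
      define U where "U = T - {k}"
      \<comment> \<open>For \<open>U = {}\<close> row \<open>p\<close> is still
        \<open>\<beta>\<close>, which is not in \<open>R\<close>, so preservation does not apply and
        \<open>inn\<close> takes its place.\<close>
      have "R (op (X'(p := sub U b)))"
      proof (cases "U = {}")
        case True
        have "X'(p := \<beta>) = X'" using Xp q by (auto simp: X'_def)
        then show ?thesis using True inn by (simp add: X'_def)
      next
        case False
        then have "R (sub U b)" using b[of U] T by (auto simp: U_def)
        then show ?thesis using rows Rq by (intro R_op) (auto simp: X'_def)
      qed
      from \<psi>R[OF this] show ?thesis
      proof (rule R_cong)
        fix l assume l: "l < n"
        show "\<psi> l (op (X'(p := sub U b)) l) = sub T c l"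
        proof (cases "l = k")
          case True
          then show ?thesis using \<open>k \<in> T\<close> colp'[of "sub U b" l] by (simp add: sub_def c_def U_def)
        next
          case False
          then show ?thesis
            using l \<psi>\<beta> colq[of l "sub U b"] colp[of "sub U b" l] colb[of "sub U b" l]
            by (auto simp: sub_def c_def U_def)
        qed
      qed
    qed
  qed
qed

text \<open>Consider matrices with rows in \<open>C\<close> or equal to \<open>\<beta>\<close> whose
  value is outside \<open>R\<close>. One with the most rows from \<open>C\<close> has two free rows
  left, and filling either or both of them lands in \<open>R\<close> by maximality. After moving the
  value to \<open>\<beta>\<close>, one row supplies the coordinates in \<open>S - {i}\<close> and
  the other supplies \<open>i\<close>.\<close>

lemma good_absorb:
  assumes CR: "\<And>x. x \<in> C \<Longrightarrow> R x" and i: "i \<in> S"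
    and face: "\<And>T. T \<subseteq> S - {i} \<Longrightarrow> T \<noteq> {} \<Longrightarrow> sub T b \<in> C" and single: "sub {i} b \<in> C"
    and absorb: "\<And>X p. p < m \<Longrightarrow> (\<And>j. j < m \<Longrightarrow> j \<noteq> p \<Longrightarrow> X j \<in> C) \<Longrightarrow> X p = \<beta> \<Longrightarrow> R (op X)"
  shows "good S"
proof -
  define P where "P Q X \<longleftrightarrow> Q \<subseteq> {..<m} \<and> (\<forall>j\<in>Q. X j \<in> C) \<and> (\<forall>j. j \<notin> Q \<longrightarrow> X j = \<beta>) \<and> \<not> R (op X)"
    for Q and X :: "nat \<Rightarrow> nat \<Rightarrow> 'a"
  have "\<not> R (op (\<lambda>_. \<beta>))"
    using key_tuple_notin R_cong[of "op (\<lambda>_. \<beta>)" \<beta>] op_const by blast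
  then have "P {} (\<lambda>_. \<beta>)" by (simp add: P_def)
  moreover have "\<forall>Q. (\<exists>X. P Q X) \<longrightarrow> card Q < Suc m"
    using card_mono[of "{..<m}"] by (auto simp: P_def less_Suc_eq_le)
  ultimately obtain Q X where PQ: "P Q X" and maxQ: "\<And>Q' X'. P Q' X' \<Longrightarrow> card Q' \<le> card Q"
    using ex_has_greatest_nat[of "\<lambda>Q. \<exists>X. P Q X" "{}" card "Suc m"] by blast
  have Q: "Q \<subseteq> {..<m}" "\<And>j. j \<in> Q \<Longrightarrow> X j \<in> C" "\<And>j. j \<notin> Q \<Longrightarrow> X j = \<beta>" "\<not> R (op X)"
    using PQ by (auto simp: P_def)
  have finQ: "finite Q" using Q(1) finite_subset by blast
  \<comment> \<open>Without a free row all rows would be in \<open>R\<close>; exactly one free row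
    is excluded by \<open>absorb\<close>.\<close>
  obtain p where p: "p < m" "p \<notin> Q"
    using Q R_op[of X] CR by blast
  obtain q where q: "q < m" "q \<notin> Q" "q \<noteq> p"
    using Q absorb[of p X] p by blast
  have bigger: "R (op X')" if "P' \<subseteq> {..<m}" "Q \<subset> P'" "\<And>j. j \<in> P' \<Longrightarrow> X' j \<in> C"
    "\<And>j. j \<notin> P' \<Longrightarrow> X' j = \<beta>" for P' X'
  proof (rule ccontr)
    assume "\<not> R (op X')"
    then have "P P' X'" using that by (auto simp: P_def)
    moreover have "card Q < card P'" using that by (intro psubset_card_mono) (auto intro: finite_subset)
    ultimately show False using maxQ by force
  qed
  have entry: "X j l \<in> A" if "l < n" for j l
    using that Q(2,3)[of j] CR R_A key_tuple_A by (cases "j \<in> Q") auto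
  obtain \<psi> where \<psi>R: "\<And>x. R x \<Longrightarrow> R (\<lambda>l. \<psi> l (x l))"
    and \<psi>\<beta>: "\<And>l. l < n \<Longrightarrow> \<psi> l (op X l) = \<beta> l"
    using key[of "op X", OF op_A[of _ X] Q(4)] entry by blast
  define c where "c l = \<psi> l (op (if l = i then X(q := b) else X(p := b)) l)" for l
  show ?thesis
  proof (rule goodI)
    fix T assume T: "T \<subseteq> S" "T \<noteq> {}"
    define x y where "x = sub (T - {i}) b" and "y = sub (T \<inter> {i}) b"
    \<comment> \<open>A row counts as newly filled only if its tuple is a proper corner rather than
      \<open>\<beta>\<close>. Since \<open>T\<close> is nonempty, at least one of the two
      does.\<close>
    define Q' where "Q' = Q \<union> (if T - {i} = {} then {} else {p}) \<union> (if i \<in> T then {q} else {})"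
    have "R (op (X(p := x, q := y)))"
    proof (rule bigger[of Q'])
      show "Q' \<subseteq> {..<m}" "Q \<subset> Q'" using Q p q T by (auto simp: Q'_def)
      show "(X(p := x, q := y)) j \<in> C" if "j \<in> Q'" for j
        using that Q(2) face[of "T - {i}"] single T p q
        by (auto simp: Q'_def x_def y_def split: if_splits)
      show "(X(p := x, q := y)) j = \<beta>" if "j \<notin> Q'" for j
        using that Q(3) p q by (auto simp: Q'_def x_def y_def sub_def fun_eq_iff split: if_splits)
    qed
    from \<psi>R[OF this] show "R (sub T c)"
    proof (rule R_cong)
      fix l assume l: "l < n"
      have "op (X(p := x, q := y)) l =
        (if l \<notin> T then op X l else op (if l = i then X(q := b) else X(p := b)) l)"
        using p q Q(3) by (auto simp: op_def x_def y_def sub_def intro!: g_cong)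
      then show "\<psi> l (op (X(p := x, q := y)) l) = sub T c l"
        using \<psi>\<beta>[OF l] by (simp add: sub_def c_def)
    qed
  qed
qed

text \<open>If \<open>S\<close> were not good, \<open>good_cross\<close> would forbid every
  crossing, so moving one row step by step inside \<open>R\<close> could never take the value of
  \<open>op\<close> out of \<open>R\<close>. This yields the absorption hypothesis of
  \<open>good_absorb\<close> for the part \<open>C\<close> of \<open>R\<close> that is reachable
  from one corner.\<close>

lemma good_step:
  assumes S: "S \<subseteq> {..<n}" "3 \<le> card S" and faces: "\<And>k. k \<in> S \<Longrightarrow> good (S - {k})"
  shows "good S"
proof (rule ccontr)
  assume bad: "\<not> good S"
  obtain V where "V \<subseteq> S" "card V = 3" using obtain_subset_with_card_n[OF S(2)] by blast
  then obtain i i1 i2 where i: "i \<in> S" "i1 \<in> S" "i2 \<in> S" "i \<noteq> i1" "i \<noteq> i2" "i1 \<noteq> i2"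
    by (auto simp: card_3_iff)
  obtain d where d: "\<And>T. T \<subseteq> S - {i} \<Longrightarrow> T \<noteq> {} \<Longrightarrow> R (sub T d)"
    using faces[OF i(1)] unfolding good_def by blast
  obtain e where e: "\<And>T. T \<subseteq> S - {i1} \<Longrightarrow> T \<noteq> {} \<Longrightarrow> R (sub T e)"
    using faces[OF i(2)] unfolding good_def by blast
  define step where "step x y \<longleftrightarrow> R y \<and> (\<exists>k\<in>S. \<exists>v. y = x(k := v))" for x y :: "nat \<Rightarrow> 'a"
  define c0 where "c0 = sub (S - {i}) d"
  define C where "C = {x. step\<^sup>*\<^sup>* c0 x}"
  have R_c0: "R c0" using d[of "S - {i}"] i by (auto simp: c0_def)
  have CR: "R x" if "x \<in> C" for x
  proof -
    have "step\<^sup>*\<^sup>* c0 x" using that by (simp add: C_def)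
    then show ?thesis by (induction rule: rtranclp_induct) (auto simp: R_c0 step_def)
  qed
  have C_step: "x(k := v) \<in> C" if "x \<in> C" "k \<in> S" "R (x(k := v))" for x k v
  proof -
    have "step x (x(k := v))" using that by (auto simp: step_def)
    then show ?thesis using that(1) by (simp add: C_def rtranclp.rtrancl_into_rtrancl)
  qed
  \<comment> \<open>Starting from \<open>c0\<close>, coordinates are reset to \<open>\<beta>\<close>
    one at a time; every corner passed is indexed by a nonempty set and hence in
    \<open>R\<close>.\<close>
  have C_diff: "sub (S - {i} - U) d \<in> C" if "finite U" "U \<subseteq> S - {i}" "S - {i} - U \<noteq> {}" for U
    using that
  proof (induction U rule: finite_induct)
    case empty
    then show ?case by (simp add: C_def c0_def)
  next
    case (insert u U)
    have "sub (S - {i} - insert u U) d = (sub (S - {i} - U) d)(u := \<beta> u)"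
      by (auto simp: sub_def)
    moreover have "R (sub (S - {i} - insert u U) d)"
      using insert.prems by (intro d) auto
    moreover have "sub (S - {i} - U) d \<in> C"
      using insert.prems by (intro insert.IH) blast+
    ultimately show ?case
      using insert.prems C_step[of "sub (S - {i} - U) d" u "\<beta> u"] by (metis Diff_iff insert_subset)
  qed
  have C_face: "sub T d \<in> C" if "T \<subseteq> S - {i}" "T \<noteq> {}" for T
  proof -
    have "S - {i} - (S - {i} - T) = T" using that by blast
    then show ?thesis using C_diff[of "S - {i} - T"] that finite_subset[OF S(1)] by auto
  qed
  \<comment> \<open>The walk from the facet of \<open>d\<close> to that of \<open>e\<close> passes
    the corners \<open>{i2}\<close>, \<open>{i, i2}\<close> and \<open>{i}\<close> of
    \<open>e\<close>. It requires a coordinate \<open>i2\<close> that both facets share.\<close>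
  have "sub {i2} d \<in> C" using i by (intro C_face) auto
  moreover have "sub {i2} e = (sub {i2} d)(i2 := e i2)" by (auto simp: sub_def)
  moreover have "R (sub {i2} e)" using i by (intro e) auto
  ultimately have "sub {i2} e \<in> C" using C_step[of "sub {i2} d" i2 "e i2"] i by simp
  moreover have "sub {i, i2} e = (sub {i2} e)(i := e i)" by (auto simp: sub_def)
  moreover have "R (sub {i, i2} e)" using i by (intro e) auto
  ultimately have "sub {i, i2} e \<in> C" using C_step[of "sub {i2} e" i "e i"] i by simp
  moreover have "sub {i} e = (sub {i, i2} e)(i2 := \<beta> i2)" using i by (auto simp: sub_def)
  moreover have "R (sub {i} e)" using i by (intro e) auto
  ultimately have C_single: "sub {i} e \<in> C"
    using C_step[of "sub {i, i2} e" i2 "\<beta> i2"] i by simp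
  have "good S"
  proof (rule good_absorb[of C i S "d(i := e i)"])
    show "sub T (d(i := e i)) \<in> C" if "T \<subseteq> S - {i}" "T \<noteq> {}" for T
    proof -
      have "sub T (d(i := e i)) = sub T d" using that by (auto simp: sub_def fun_eq_iff)
      then show ?thesis using C_face that by simp
    qed
    have "sub {i} (d(i := e i)) = sub {i} e" by (auto simp: sub_def fun_eq_iff)
    then show "sub {i} (d(i := e i)) \<in> C" using C_single by simp
  next
    fix X p assume p: "p < m" and X: "\<And>j. j < m \<Longrightarrow> j \<noteq> p \<Longrightarrow> X j \<in> C" "X p = \<beta>"
    \<comment> \<open>The induction is on a set \<open>Q\<close> containing every row other than
      \<open>p\<close> that may differ from \<open>c0\<close>.\<close>
    have "R (op X)" if "finite Q" "\<And>j. j < m \<Longrightarrow> j \<noteq> p \<Longrightarrow> X j \<in> C" "X p = \<beta>"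
      "\<And>j. j < m \<Longrightarrow> j \<noteq> p \<Longrightarrow> j \<notin> Q \<Longrightarrow> X j = c0" for X Q
      using that
    proof (induction Q arbitrary: X rule: finite_induct)
      case empty
      obtain q where q: "q < m" "q \<noteq> p"
      proof (cases "p = 0")
        case True then show ?thesis using that[of 1] arity by simp
      next
        case False then show ?thesis using that[of 0] arity by simp
      qed
      \<comment> \<open>The weak near-unanimity identity moves the zero of column \<open>i1\<close> from row \<open>p\<close> to row \<open>q\<close>,
        so that no row is \<open>\<beta>\<close> any more.\<close>
      define Y where "Y = (\<lambda>j. if j = p then sub {i1} d else if j = q then sub (S - {i} - {i1}) d else c0)"
      have Ri1: "R (sub {i1} d)" using i by (intro d) auto
      have "R (sub (S - {i} - {i1}) d)" using i by (intro d) auto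
      then have "R (op Y)" using Ri1 R_c0 by (intro R_op) (auto simp: Y_def)
      then show ?case
      proof (rule R_cong)
        fix k assume k: "k < n"
        show "op Y k = op X k"
        proof (cases "k = i1")
          case True
          have "d i1 \<in> A" using R_A[OF Ri1 k] True by (simp add: sub_def)
          then have "g ((\<lambda>_. d i1)(q := \<beta> i1)) = g ((\<lambda>_. d i1)(p := \<beta> i1))"
            using key_tuple_A k True p q by (intro g_wnu) auto
          moreover have "op Y k = g ((\<lambda>_. d i1)(q := \<beta> i1))"
            unfolding op_def using True i q by (intro g_cong) (auto simp: Y_def sub_def c0_def)
          moreover have "op X k = g ((\<lambda>_. d i1)(p := \<beta> i1))"
            unfolding op_def using True i q empty by (intro g_cong) (auto simp: sub_def c0_def)
          ultimately show ?thesis by simp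
        next
          case False
          then show ?thesis unfolding op_def
            using i q empty by (intro g_cong) (auto simp: Y_def sub_def c0_def)
        qed
      qed
    next
      case (insert q Q)
      show ?case
      proof (cases "q < m \<and> q \<noteq> p")
        case False
        then show ?thesis using insert.prems by (intro insert.IH) auto
      next
        case True
        \<comment> \<open>Row \<open>q\<close> is moved from \<open>c0\<close> along a walk; the
          endpoint of interest is \<open>X q\<close>.\<close>
        have "R (op (X(q := x)))" if "step\<^sup>*\<^sup>* c0 x" for x
          using that
        proof (induction rule: rtranclp_induct)
          case base
          have "c0 \<in> C" by (simp add: C_def)
          then show ?case using insert.prems True by (intro insert.IH) auto
        next
          case (step x y)
          obtain k v where kv: "k \<in> S" "y = x(k := v)" and Ry: "R y"
            using step.hyps(2) by (auto simp: step_def)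
          have Rx: "R x" using step.hyps(1) CR by (simp add: C_def)
          have yx: "y(k := x k) = x" using kv by auto
          show ?case
          proof (rule ccontr)
            assume out: "\<not> R (op (X(q := y)))"
            \<comment> \<open>The crossing is used backwards: with \<open>y\<close> in row
              \<open>q\<close> the value is outside \<open>R\<close>, and restoring
              \<open>x k\<close> brings it back in.\<close>
            have "good S"
            proof (rule good_cross[of p "X(q := y)" q k S "x k"])
              show "R ((X(q := y)) j)" if "j < m" "j \<noteq> p" for j
                using that insert.prems(1) CR Ry by auto
              show "(X(q := y)) p = \<beta>" using insert.prems True by auto
              show "R (((X(q := y)) q)(k := x k))" using yx Rx by simp
              show "R (op ((X(q := y))(q := ((X(q := y)) q)(k := x k))))" 
                using yx step.IH by (simp add: fun_upd_def[of X q x])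
            qed (use out True kv faces in auto)
            then show False using bad by simp
          qed
        qed
        from this[of "X q"] show ?thesis using insert.prems(1)[of q] True by (simp add: C_def)
      qed
    qed
    from this[of "{..<m}" X] show "R (op X)" using X by auto
  qed (use CR i in auto)
  then show False using bad by simp
qed

lemma good_of_pairs:
  assumes "\<And>i j. i \<in> V \<Longrightarrow> j \<in> V \<Longrightarrow> i \<noteq> j \<Longrightarrow> good {i, j}" and "V \<subseteq> {..<n}"
    and "S \<subseteq> V" and "2 \<le> card S"
  shows "good S"
  using assms(3,4)
proof (induction "card S" arbitrary: S rule: less_induct)
  case less
  have sub: "S \<subseteq> {..<n}" using less.prems(1) assms(2) by (rule order_trans)
  then have fin: "finite S" by (rule finite_subset) simp
  show ?case
  proof (cases "card S = 2")
    case True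
    then obtain i j where "S = {i, j}" "i \<noteq> j" by (auto simp: card_2_iff)
    then show ?thesis using assms(1)[of i j] less.prems by simp
  next
    case False
    show ?thesis
    proof (rule good_step)
      fix k assume k: "k \<in> S"
      have "card (S - {k}) = card S - 1" using k fin by simp
      then show "good (S - {k})"
        using k less.prems False by (intro less.hyps) auto
    qed (use sub less.prems(2) False in auto)
  qed
qed

lemma good_pair:
  assumes ij: "i < n" "j < n" "i \<noteq> j" and c: "\<And>k. k < n \<Longrightarrow> c k \<in> A" "\<not> R c"
    and R: "R (c(i := x))" "R (c(j := y))" "R (c(i := x, j := y))"
  shows "good {i, j}"
proof -
  obtain \<psi> where \<psi>R: "\<And>t. R t \<Longrightarrow> R (\<lambda>l. \<psi> l (t l))" and \<psi>\<beta>: "\<And>l. l < n \<Longrightarrow> \<psi> l (c l) = \<beta> l"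
    using key[OF c] by blast
  define b where "b l = \<psi> l (if l = i then x else y)" for l
  show ?thesis
  proof (rule goodI)
    fix T assume "T \<subseteq> {i, j}" "T \<noteq> {}"
    then consider "T = {i}" | "T = {j}" | "T = {i, j}" by blast
    then show "R (sub T b)"
    proof cases
      case 1
      then show ?thesis
        using \<psi>\<beta> by (intro R_cong[OF \<psi>R[OF R(1)]]) (auto simp: sub_def b_def)
    next
      case 2
      then show ?thesis
        using \<psi>\<beta> ij by (intro R_cong[OF \<psi>R[OF R(2)]]) (auto simp: sub_def b_def)
    next
      case 3
      then show ?thesis
        using \<psi>\<beta> ij by (intro R_cong[OF \<psi>R[OF R(3)]]) (auto simp: sub_def b_def)
    qed
  qed
qed

section \<open>Merging the facets that omit coordinates 0 and 1\<close>

text \<open>The contrapositive form of \<open>pattern A n rho 0 1\<close>. The entries lie in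
  \<open>A\<close> automatically, since they occur in tuples of \<open>R\<close>.\<close>

definition rectangular :: bool where
  "rectangular \<longleftrightarrow> (\<forall>c x y x' y'. R (c(0 := x', 1 := y)) \<longrightarrow> R (c(0 := x, 1 := y')) \<longrightarrow>
    R (c(0 := x', 1 := y')) \<longrightarrow> R (c(0 := x, 1 := y)))"

lemma rectangularD:
  "rectangular \<Longrightarrow> R (c(0 := x', 1 := y)) \<Longrightarrow> R (c(0 := x, 1 := y')) \<Longrightarrow>
    R (c(0 := x', 1 := y')) \<Longrightarrow> R (c(0 := x, 1 := y))"
  unfolding rectangular_def by blast

text \<open>Let \<open>S\<close> be the part of \<open>T\<close> beyond coordinate 1. For nonempty
  \<open>S\<close> the corner using both 0 and 1 is the fourth corner of a rectangle through
  \<open>sub S b\<close>. For empty \<open>S\<close> that rectangle starts at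
  \<open>\<beta>\<close>, outside \<open>R\<close>, whence the exception
  \<open>{0, 1}\<close>.\<close>

lemma cube_from_rectangles:
  assumes rect: rectangular
    and b: "R (sub {0} b)" "R (sub {1} b)"
    and S: "\<And>S. S \<subseteq> {2..<n} \<Longrightarrow> S \<noteq> {} \<Longrightarrow>
      R (sub S b) \<and> R (sub (insert 0 S) b) \<and> R (sub (insert 1 S) b)"
    and T: "T \<subseteq> {..<n}" "T \<noteq> {}" "T \<noteq> {0, 1}"
  shows "R (sub T b)"
proof -
  define S where "S = T - {0, 1}"
  have S2: "S \<subseteq> {2..<n}" using T(1) by (auto simp: S_def)
  then have notin: "0 \<notin> S" "1 \<notin> S" by auto
  show ?thesis
  proof (cases "S = {}")
    case True
    then have "T = {0} \<or> T = {1}" using T by (auto simp: S_def)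
    then show ?thesis using b by auto
  next
    case False
    note RS = S[OF S2 False]
    have eqs: "(sub S b)(0 := \<beta> 0, 1 := b 1) = sub (insert 1 S) b"
      "(sub S b)(0 := b 0, 1 := \<beta> 1) = sub (insert 0 S) b"
      "(sub S b)(0 := \<beta> 0, 1 := \<beta> 1) = sub S b"
      "(sub S b)(0 := b 0, 1 := b 1) = sub (insert 0 (insert 1 S)) b"
      using notin by (auto simp: sub_def fun_eq_iff)
    have "R (sub (insert 0 (insert 1 S)) b)"
      using rectangularD[OF rect, of "sub S b" "\<beta> 0" "b 1" "b 0" "\<beta> 1"] RS unfolding eqs by blast
    moreover have "T = S \<or> T = insert 0 S \<or> T = insert 1 S \<or> T = insert 0 (insert 1 S)"
      by (auto simp: S_def)
    ultimately show ?thesis using RS by auto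
  qed
qed

text \<open>By \<open>z\<close>, the value of \<open>g\<close> on one \<open>\<beta> 1\<close> and
  otherwise \<open>d 1\<close> can serve as coordinate 1 of the cube. Coordinate 0 is taken from
  \<open>e\<close>, and the later ones are values of \<open>g\<close> on one \<open>e k\<close> and
  otherwise \<open>\<beta> k\<close>.\<close>

lemma cube_of_faces_absorbing:
  assumes n: "3 \<le> n"
    and rect: rectangular
    and d: "R (sub {1} d)"
    and e: "\<And>T. T \<subseteq> {..<n} - {1} \<Longrightarrow> T \<noteq> {} \<Longrightarrow> R (sub T e)"
    and z: "R (sub {1} (\<lambda>k. g ((\<lambda>_. d k)(0 := \<beta> k))))"
  shows "\<exists>b. \<forall>T. T \<subseteq> {..<n} \<longrightarrow> T \<noteq> {} \<longrightarrow> T \<noteq> {0, 1} \<longrightarrow> R (sub T b)"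
proof -
  define b where "b k = (if k = 0 then e 0 else if k = 1 then g ((\<lambda>_. d k)(0 := \<beta> k))
    else g ((\<lambda>_. \<beta> k)(0 := e k)))" for k
  \<comment> \<open>One argument at a time, \<open>u\<close> passes from \<open>\<beta> 0\<close> to
    \<open>e 0\<close> and \<open>w\<close> from \<open>d 1\<close> to
    \<open>\<beta> 1\<close>.\<close>
  define u where "u r = g (\<lambda>j. if j < r then e 0 else \<beta> 0)" for r :: nat
  define w where "w r = g (\<lambda>j. if j < r then \<beta> 1 else d 1)" for r :: nat
  have e_A: "e k \<in> A" if "k < n" "k \<noteq> 1" for k
    using R_A[OF e[of "{k}"], of k] that by (simp add: sub_def)
  have ends: "u 0 = \<beta> 0" "u m = e 0" "w 1 = b 1" "w m = \<beta> 1"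
  proof -
    show "u 0 = \<beta> 0" using n by (simp add: u_def g_idem key_tuple_A)
    have "u m = g (\<lambda>_. e 0)" unfolding u_def by (rule g_cong) simp
    then show "u m = e 0" using n e_A by (simp add: g_idem)
    show "w 1 = b 1" unfolding w_def b_def by (auto intro: g_cong)
    have "w m = g (\<lambda>_. \<beta> 1)" unfolding w_def by (rule g_cong) simp
    then show "w m = \<beta> 1" using n by (simp add: g_idem key_tuple_A)
  qed
  have "R (sub T b)" if T: "T \<subseteq> {..<n}" "T \<noteq> {}" "T \<noteq> {0, 1}" for T
  proof (rule cube_from_rectangles[OF rect])
    have "sub {0} b = sub {0} e" by (auto simp: sub_def b_def fun_eq_iff)
    then show "R (sub {0} b)" using e[of "{0}"] n by simp
    have "sub {1} b = sub {1} (\<lambda>k. g ((\<lambda>_. d k)(0 := \<beta> k)))"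
      by (auto simp: sub_def b_def fun_eq_iff)
    then show "R (sub {1} b)" using z by simp
  next
    fix S :: "nat set" assume S: "S \<subseteq> {2..<n}" "S \<noteq> {}"
    have notin: "0 \<notin> S" "1 \<notin> S" using S by auto
    define E where "E x y \<longleftrightarrow> R ((sub S b)(0 := x, 1 := y))" for x y
    have E_rect: "E x' y \<Longrightarrow> E x y' \<Longrightarrow> E x' y' \<Longrightarrow> E x y" for x y x' y'
      unfolding E_def by (rule rectangularD[OF rect])
    have edge: "E (u (if h then Suc r else r)) (w (Suc r))" if r: "r < m" for r h
    proof -
      \<comment> \<open>In a column \<open>k\<close> of \<open>S\<close> only row \<open>r\<close>
        holds \<open>e k\<close>, so by the WNU identity the value is \<open>b k\<close> for every
        \<open>r\<close>, while columns 0 and 1 run through \<open>u\<close> and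
        \<open>w\<close>.\<close>
      define X where "X j = (if j = r then sub (if h then insert 0 S else S) e
        else if j < r then sub {0} e else sub {1} d)" for j
      have "R (sub {0} e)" "R (sub (insert 0 S) e)" "R (sub S e)"
        using S n by (auto intro!: e)
      then have "R (op X)" using d by (intro R_op) (auto simp: X_def)
      then show ?thesis unfolding E_def
      proof (rule R_cong)
        fix k assume k: "k < n"
        consider "k = 0" | "k = 1" | "k \<in> S" "k \<noteq> 0" "k \<noteq> 1" | "k \<notin> S" "k \<noteq> 0" "k \<noteq> 1" by blast
        then show "op X k = ((sub S b)(0 := u (if h then Suc r else r), 1 := w (Suc r))) k"
        proof cases
          case 1
          then show ?thesis using notin
            by (auto simp: op_def u_def X_def sub_def intro!: g_cong)
        next
          case 2
          then show ?thesis using notin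
            by (auto simp: op_def w_def X_def sub_def intro!: g_cong)
        next
          case 3
          have "op X k = g ((\<lambda>_. \<beta> k)(r := e k))"
            unfolding op_def using 3 by (intro g_cong) (auto simp: X_def sub_def)
          also have "\<dots> = g ((\<lambda>_. \<beta> k)(0 := e k))"
            using 3 k r arity e_A key_tuple_A by (intro g_wnu) auto
          finally show ?thesis using 3 by (simp add: sub_def b_def)
        next
          case 4
          have "op X k = g (\<lambda>_. \<beta> k)"
            unfolding op_def using 4 by (intro g_cong) (auto simp: X_def sub_def)
          then show ?thesis using 4 k by (simp add: sub_def g_idem key_tuple_A)
        qed
      qed
    qed
    \<comment> \<open>The rectangle property propagates along the zigzag
      \<open>u 0, w 1, u 1, w 2, \<dots>, u m\<close>, whose consecutive members are related.\<close>
    have chain: "E (u 0) (w (Suc r))" if "r < m" for r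
      using that
    proof (induction r)
      case 0
      then show ?case using edge[of 0 False] by simp
    next
      case (Suc r)
      show ?case
        using E_rect[of "u (Suc r)" "w (Suc (Suc r))" "u 0" "w (Suc r)"] Suc
          edge[of "Suc r" False] edge[of r True] by simp
    qed
    have m': "Suc (m - 1) = m" using arity by simp
    have "R ((sub S b)(0 := \<beta> 0, 1 := \<beta> 1))"
      using chain[of "m - 1"] m' ends arity by (simp add: E_def)
    moreover have "(sub S b)(0 := \<beta> 0, 1 := \<beta> 1) = sub S b"
      using notin by (auto simp: sub_def fun_eq_iff)
    moreover have "R ((sub S b)(0 := e 0, 1 := \<beta> 1))"
      using edge[of "m - 1" True] m' ends arity by (simp add: E_def)
    moreover have "(sub S b)(0 := e 0, 1 := \<beta> 1) = sub (insert 0 S) b"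
      using notin by (auto simp: sub_def b_def fun_eq_iff)
    moreover have "R ((sub S b)(0 := \<beta> 0, 1 := b 1))"
      using chain[of 0] ends arity by (simp add: E_def)
    moreover have "(sub S b)(0 := \<beta> 0, 1 := b 1) = sub (insert 1 S) b"
      using notin by (auto simp: sub_def fun_eq_iff)
    ultimately show "R (sub S b) \<and> R (sub (insert 0 S) b) \<and> R (sub (insert 1 S) b)"
      by simp
  qed (use T in auto)
  then show ?thesis by blast
qed

text \<open>Here \<open>?z\<close> is outside \<open>R\<close> and agrees with
  \<open>\<beta>\<close> off coordinate 1. The \<open>\<psi>\<close> moving it to
  \<open>\<beta>\<close> fixes \<open>\<beta> k\<close> for the other \<open>k < n\<close> and sends
  the value of \<open>g\<close> on one \<open>\<beta> 1\<close> and otherwise \<open>d 1\<close> to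
  \<open>\<beta> 1\<close>. So a single \<open>\<beta> 1\<close> in column 1 resets that coordinate,
  whereas a column constantly \<open>d 1\<close> gives \<open>b 1\<close>.\<close>

lemma cube_of_faces_nonabsorbing:
  assumes n: "3 \<le> n"
    and rect: rectangular
    and e: "R (sub {0} e)"
    and d: "\<And>T. T \<subseteq> {..<n} - {0} \<Longrightarrow> T \<noteq> {} \<Longrightarrow> R (sub T d)"
    and z: "\<not> R (sub {1} (\<lambda>k. g ((\<lambda>_. d k)(0 := \<beta> k))))" (is "\<not> R ?z")
  shows "\<exists>b. \<forall>T. T \<subseteq> {..<n} \<longrightarrow> T \<noteq> {} \<longrightarrow> T \<noteq> {0, 1} \<longrightarrow> R (sub T b)"
proof -
  have d_A: "d k \<in> A" if "k < n" "k \<noteq> 0" for k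
    using R_A[OF d[of "{k}"], of k] that by (simp add: sub_def)
  have d0_A: "g ((\<lambda>_. d k)(0 := \<beta> k)) \<in> A" if "k < n" "k \<noteq> 0" for k
    using that d_A key_tuple_A by (intro g_A) auto
  have z_A: "?z k \<in> A" if "k < n" for k
    using that d0_A key_tuple_A by (simp add: sub_def)
  obtain \<psi> where \<psi>R: "\<And>x. R x \<Longrightarrow> R (\<lambda>l. \<psi> l (x l))"
    and \<psi>z: "\<And>l. l < n \<Longrightarrow> \<psi> l (?z l) = \<beta> l"
    using key[OF z_A z] by blast
  have \<psi>\<beta>: "\<psi> k (\<beta> k) = \<beta> k" if "k < n" "k \<noteq> 1" for k
    using \<psi>z[of k] that by (simp add: sub_def)
  have \<psi>1: "\<psi> 1 (g ((\<lambda>_. d 1)(0 := \<beta> 1))) = \<beta> 1"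
    using \<psi>z[of 1] n by (simp add: sub_def)
  define b where "b k = \<psi> k (if k = 0 then g ((\<lambda>_. \<beta> 0)(0 := e 0)) else if k = 1 then d 1
    else g ((\<lambda>_. d k)(0 := \<beta> k)))" for k
  have shift: "g ((\<lambda>_. d 1)(1 := \<beta> 1)) = g ((\<lambda>_. d 1)(0 := \<beta> 1))"
    using n arity d_A key_tuple_A by (intro g_wnu) auto
  have const: "g (\<lambda>_. \<beta> k) = \<beta> k" "k \<noteq> 0 \<Longrightarrow> g (\<lambda>_. d k) = d k" if "k < n" for k
    using that d_A key_tuple_A by (auto simp: g_idem)
  have "R (sub T b)" if T: "T \<subseteq> {..<n}" "T \<noteq> {}" "T \<noteq> {0, 1}" for T
  proof (rule cube_from_rectangles[OF rect])
    have R1: "R (sub {1} d)" using n by (intro d) auto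
    from \<psi>R[OF R1] show "R (sub {1} b)"
      by (rule R_cong) (auto simp: sub_def b_def \<psi>\<beta>)
    define X where "X j = (if j = 0 then sub {0} e else sub {1} d)" for j :: nat
    have "R (op X)" using e R1 by (intro R_op) (auto simp: X_def)
    from \<psi>R[OF this] show "R (sub {0} b)"
    proof (rule R_cong)
      fix k assume k: "k < n"
      have "op X k = g (if k = 0 then (\<lambda>_. \<beta> 0)(0 := e 0) else if k = 1 then (\<lambda>_. d 1)(0 := \<beta> 1)
        else (\<lambda>_. \<beta> k))"
        unfolding op_def by (intro g_cong) (auto simp: X_def sub_def)
      then show "\<psi> k (op X k) = sub {0} b k"
        using k \<psi>1 by (simp add: sub_def b_def const \<psi>\<beta>)
    qed
  next
    fix S :: "nat set" assume S: "S \<subseteq> {2..<n}" "S \<noteq> {}"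
    have notin: "0 \<notin> S" "1 \<notin> S" using S by auto
    have RS: "R (sub {1} d)" "R (sub (insert 1 S) d)" "R (sub S d)"
      using S n by (auto intro!: d)
    have "R (sub S b)"
    proof -
      \<comment> \<open>The \<open>\<beta>\<close> entries of column 1 and of the columns in
        \<open>S\<close> sit in different rows, as one row holding all of them would be
        \<open>\<beta>\<close> itself. \<open>shift\<close> makes up for the different
        position.\<close>
      define X where "X j = (if j = 0 then sub {1} d else if j = 1 then sub S d
        else sub (insert 1 S) d)" for j :: nat
      have "R (op X)" using RS by (intro R_op) (auto simp: X_def)
      from \<psi>R[OF this] show ?thesis
      proof (rule R_cong)
        fix k assume k: "k < n"
        have "op X k = g (if k = 1 then (\<lambda>_. d 1)(1 := \<beta> 1)
          else if k \<in> S then (\<lambda>_. d k)(0 := \<beta> k) else (\<lambda>_. \<beta> k))"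
          unfolding op_def using notin by (intro g_cong) (auto simp: X_def sub_def)
        then show "\<psi> k (op X k) = sub S b k"
          using k \<psi>1 notin shift by (auto simp: sub_def b_def const \<psi>\<beta>)
      qed
    qed
    moreover have "R (sub (insert 1 S) b)"
    proof -
      define X where "X j = (if j = 0 then sub {1} d else sub (insert 1 S) d)" for j :: nat
      have "R (op X)" using RS by (intro R_op) (auto simp: X_def)
      from \<psi>R[OF this] show ?thesis
      proof (rule R_cong)
        fix k assume k: "k < n"
        have "op X k = g (if k = 1 then (\<lambda>_. d 1)
          else if k \<in> S then (\<lambda>_. d k)(0 := \<beta> k) else (\<lambda>_. \<beta> k))"
          unfolding op_def using notin by (intro g_cong) (auto simp: X_def sub_def)
        then show "\<psi> k (op X k) = sub (insert 1 S) b k"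
          using k notin by (auto simp: sub_def b_def const \<psi>\<beta>)
      qed
    qed
    moreover have "R (sub (insert 0 S) b)"
    proof -
      define X where "X j = (if j = 0 then sub {0} e else sub (insert 1 S) d)" for j :: nat
      have "R (op X)" using RS e by (intro R_op) (auto simp: X_def)
      from \<psi>R[OF this] show ?thesis
      proof (rule R_cong)
        fix k assume k: "k < n"
        have "op X k = g (if k = 0 then (\<lambda>_. \<beta> 0)(0 := e 0) else if k = 1 then (\<lambda>_. d 1)(0 := \<beta> 1)
          else if k \<in> S then (\<lambda>_. d k)(0 := \<beta> k) else (\<lambda>_. \<beta> k))"
          unfolding op_def using notin by (intro g_cong) (auto simp: X_def sub_def)
        then show "\<psi> k (op X k) = sub (insert 0 S) b k"
          using k \<psi>1 notin by (auto simp: sub_def b_def const \<psi>\<beta>)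
      qed
    qed
    ultimately show "R (sub S b) \<and> R (sub (insert 0 S) b) \<and> R (sub (insert 1 S) b)"
      by simp
  qed (use T in auto)
  then show ?thesis by blast
qed

lemma cube_of_faces:
  assumes n: "3 \<le> n"
    and rect: rectangular
    and "good ({..<n} - {0})" "good ({..<n} - {1})"
  shows "\<exists>b. \<forall>T. T \<subseteq> {..<n} \<longrightarrow> T \<noteq> {} \<longrightarrow> T \<noteq> {0, 1} \<longrightarrow> R (sub T b)"
proof -
  obtain d where d: "\<And>T. T \<subseteq> {..<n} - {0} \<Longrightarrow> T \<noteq> {} \<Longrightarrow> R (sub T d)"
    using assms(3) unfolding good_def by blast
  obtain e where e: "\<And>T. T \<subseteq> {..<n} - {1} \<Longrightarrow> T \<noteq> {} \<Longrightarrow> R (sub T e)"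
    using assms(4) unfolding good_def by blast
  have "R (sub {1} d)" "R (sub {0} e)" using n by (auto intro!: d e)
  then show ?thesis
    using cube_of_faces_absorbing[OF n rect _ e] cube_of_faces_nonabsorbing[OF n rect _ d] by blast
qed

end

section \<open>Lists as functions\<close>

lemma map_upt_update: "i < n \<Longrightarrow> (map x [0..<n])[i := v] = map (x(i := v)) [0..<n]"
  by (auto simp: list_eq_iff_nth_eq nth_list_update)

lemma map_upt_in_tuples: "map x [0..<n] \<in> tuples A n \<longleftrightarrow> (\<forall>k<n. x k \<in> A)"
  by (auto simp: tuples_def)

lemma tuples_map_nth: "t \<in> tuples A n \<Longrightarrow> map ((!) t) [0..<n] = t"
  using map_nth[of t] by (auto simp: tuples_def)

lemma tuples_nth: "t \<in> tuples A n \<Longrightarrow> k < n \<Longrightarrow> t ! k \<in> A"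
  by (auto simp: tuples_def)

lemma pattern_rectangle:
  assumes "rho \<subseteq> tuples A n" "2 \<le> n" "pattern A n rho 0 1"
    and R: "map (c(0 := x', 1 := y)) [0..<n] \<in> rho" "map (c(0 := x, 1 := y')) [0..<n] \<in> rho"
      "map (c(0 := x', 1 := y')) [0..<n] \<in> rho"
  shows "map (c(0 := x, 1 := y)) [0..<n] \<in> rho"
proof (rule ccontr)
  let ?t = "map (c(0 := x, 1 := y)) [0..<n]"
  assume out: "?t \<notin> rho"
  have entries: "\<forall>k<n. (c(0 := x', 1 := y)) k \<in> A" "\<forall>k<n. (c(0 := x, 1 := y')) k \<in> A"
    using R(1,2) assms(1) map_upt_in_tuples by blast+
  have A: "x' \<in> A" "y \<in> A" "x \<in> A" "y' \<in> A"
    using entries[rule_format, of 0] entries[rule_format, of 1] assms(2) by auto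
  have t: "?t \<in> tuples A n"
    unfolding map_upt_in_tuples using entries(1) A by (auto split: if_splits)
  have upd: "?t[0 := x'] = map (c(0 := x', 1 := y)) [0..<n]"
    "?t[1 := y'] = map (c(0 := x, 1 := y')) [0..<n]"
    "?t[0 := x', 1 := y'] = map (c(0 := x', 1 := y')) [0..<n]"
    using assms(2) by (auto simp: list_eq_iff_nth_eq nth_list_update)
  have "?t[0 := x'] \<in> rho" unfolding upd(1) by (rule R(1))
  moreover have "?t[1 := y'] \<in> rho" unfolding upd(2) by (rule R(2))
  moreover have "?t[0 := x', 1 := y'] \<in> rho" unfolding upd(3) by (rule R(3))
  moreover have "\<not> (\<exists>t \<in> tuples A n. \<exists>di\<in>A. \<exists>dj\<in>A. t \<notin> rho \<and>
      t[0 := di] \<in> rho \<and> t[1 := dj] \<in> rho \<and> t[0 := di, 1 := dj] \<in> rho)"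
    using assms(3) unfolding pattern_def by simp
  ultimately show False
    using t A out by blast
qed

section \<open>From a cube to a key relation\<close>

text \<open>The corner \<open>a\<close> itself serves as key tuple. Each \<open>\<alpha>\<close>
  needs a vector-function with values in the cube that sends \<open>\<alpha>\<close> to
  \<open>a\<close> and keeps the images of \<open>rho\<close> away from the two exceptional
  corners.\<close>

lemma key_relation_of_cube:
  assumes n: "3 \<le> n" and rho: "rho \<subseteq> tuples A n" and pat: "pattern A n rho 0 1"
    and a: "a \<in> tuples A n - rho" and b: "b \<in> tuples A n" and ab: "\<forall>i<n. b ! i \<noteq> a ! i"
    and cube: "{x \<in> tuples A n. \<forall>i<n. x ! i \<in> {a ! i, b ! i}} - {a, take 2 b @ drop 2 a} \<subseteq> rho"
  shows "key_relation A n rho"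
  unfolding key_relation_def
proof (rule bexI[OF _ a], rule ballI)
  fix \<alpha> assume \<alpha>: "\<alpha> \<in> tuples A n - rho"
  have n2: "2 \<le> n" using n by simp
  define \<sigma> where "\<sigma> x y \<longleftrightarrow> map (((!) \<alpha>)(0 := x, 1 := y)) [0..<n] \<in> rho" for x y
  have \<sigma>_rect: "\<sigma> x' y \<Longrightarrow> \<sigma> x y' \<Longrightarrow> \<sigma> x' y' \<Longrightarrow> \<sigma> x y" for x y x' y'
    unfolding \<sigma>_def by (rule pattern_rectangle[OF rho n2 pat])
  \<comment> \<open>Rectangularity makes \<open>\<sigma>\<close> a disjoint union of blocks \<open>B \<times> C\<close>; the first two components
    of \<open>psi\<close> separate the block of \<open>\<alpha> ! 0\<close> from the others.\<close>
  define psi where "psi k x =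
    (if k = 0 then (if x = \<alpha> ! 0 \<or> (\<exists>y. \<sigma> (\<alpha> ! 0) y \<and> \<sigma> x y) then a ! 0 else b ! 0)
     else if k = 1 then (if \<sigma> (\<alpha> ! 0) x then b ! 1 else a ! 1)
     else if x = \<alpha> ! k then a ! k else b ! k)" for k x
  have len: "length a = n" "length b = n" "length \<alpha> = n"
    using a b \<alpha> by (auto simp: tuples_def)
  have psi_ab: "psi k x \<in> {a ! k, b ! k}" for k x
    by (auto simp: psi_def)
  have psi_A: "psi k x \<in> A" if "k < n" for k x
    using psi_ab[of k x] tuples_nth[of a A n k] tuples_nth[of b A n k] a b that by auto
  have "((!) \<alpha>)(0 := \<alpha> ! 0, 1 := \<alpha> ! 1) = (!) \<alpha>" by auto
  then have "\<not> \<sigma> (\<alpha> ! 0) (\<alpha> ! 1)"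
    using \<alpha> tuples_map_nth[of \<alpha> A n] by (simp add: \<sigma>_def)
  then have "apply_vf psi \<alpha> = a"
    using len by (auto simp: apply_vf_def psi_def list_eq_iff_nth_eq)
  moreover have "apply_vf psi t \<in> rho" if t: "t \<in> rho" for t
  proof -
    have tn: "t \<in> tuples A n" using t rho by blast
    then have lent: "length t = n" by (simp add: tuples_def)
    have nth: "apply_vf psi t ! k = psi k (t ! k)" if "k < n" for k
      using that lent by (simp add: apply_vf_def)
    have other: "(take 2 b @ drop 2 a) ! k = (if k < 2 then b ! k else a ! k)" if "k < n" for k
      using that len n by (auto simp: nth_append simp del: add_2_eq_Suc)
    have "apply_vf psi t \<in> tuples A n"
      using psi_A lent by (auto simp: apply_vf_def tuples_def)
    moreover have "\<forall>k<n. apply_vf psi t ! k \<in> {a ! k, b ! k}"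
    proof (intro allI impI)
      fix k assume "k < n"
      show "apply_vf psi t ! k \<in> {a ! k, b ! k}" unfolding nth[OF \<open>k < n\<close>] by (rule psi_ab)
    qed
    \<comment> \<open>Both exceptional corners agree with \<open>a\<close> from coordinate 2 on. If
      \<open>t\<close> differs from \<open>\<alpha>\<close> there, its image differs from
      \<open>a\<close> there; otherwise its first two entries are related by \<open>\<sigma>\<close>
      and go to \<open>(a ! 0, b ! 1)\<close> or \<open>(b ! 0, a ! 1)\<close>.\<close>
    moreover have "apply_vf psi t \<noteq> a \<and> apply_vf psi t \<noteq> take 2 b @ drop 2 a"
    proof (cases "\<forall>k. 2 \<le> k \<longrightarrow> k < n \<longrightarrow> t ! k = \<alpha> ! k")
      case False
      then obtain k where k: "2 \<le> k" "k < n" "t ! k \<noteq> \<alpha> ! k" by blast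
      then have "apply_vf psi t ! k \<noteq> a ! k"
        using nth[of k] ab by (simp add: psi_def)
      then show ?thesis using other[of k] k by auto
    next
      case True
      have "map (((!) \<alpha>)(0 := t ! 0, 1 := t ! 1)) [0..<n] = t"
        using True lent by (auto simp: list_eq_iff_nth_eq)
      then have \<sigma>t: "\<sigma> (t ! 0) (t ! 1)" using t by (simp add: \<sigma>_def)
      have nth01: "apply_vf psi t ! 0 = psi 0 (t ! 0)" "apply_vf psi t ! 1 = psi 1 (t ! 1)"
        using n by (auto intro!: nth)
      have ab01: "b ! 0 \<noteq> a ! 0" "b ! 1 \<noteq> a ! 1" using ab n by auto
      show ?thesis
      proof (cases "\<sigma> (\<alpha> ! 0) (t ! 1)")
        case True
        then have "psi 0 (t ! 0) = a ! 0" "psi 1 (t ! 1) = b ! 1"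
          using \<sigma>t by (auto simp: psi_def)
        then show ?thesis using nth01 ab01 other[of 0] n by auto
      next
        case False
        have "\<not> (\<exists>y. \<sigma> (\<alpha> ! 0) y \<and> \<sigma> (t ! 0) y)"
          using False \<sigma>t \<sigma>_rect[of "t ! 0" "t ! 1" "\<alpha> ! 0"] by blast
        then have "psi 0 (t ! 0) = b ! 0" "psi 1 (t ! 1) = a ! 1"
          using False \<sigma>t by (auto simp: psi_def)
        then show ?thesis using nth01 ab01 other[of 1] n by auto
      qed
    qed
    ultimately have "apply_vf psi t \<in> {x \<in> tuples A n. \<forall>i<n. x ! i \<in> {a ! i, b ! i}}
        - {a, take 2 b @ drop 2 a}"
      by (simp only: Diff_iff mem_Collect_eq insert_iff empty_iff simp_thms)
    then show ?thesis by (rule subsetD[OF cube])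
  qed
  ultimately have "vf_preserves A n psi rho \<and> apply_vf psi \<alpha> = a"
    using psi_A by (simp add: vf_preserves_def)
  then show "\<exists>psi. vf_preserves A n psi rho \<and> apply_vf psi \<alpha> = a" by blast
qed

section \<open>From a key relation to a cube\<close>

lemma key_wnu_of_key_relation:
  assumes rho: "rho \<subseteq> tuples A n" and "key_relation A n rho" "preserved_by_WNU A n rho"
  obtains \<beta> m g where "\<beta> \<in> tuples A n - rho" "key_wnu A n m (\<lambda>x. map x [0..<n] \<in> rho) ((!) \<beta>) g"
proof -
  obtain \<beta> where \<beta>: "\<beta> \<in> tuples A n - rho"
    and key: "\<And>\<alpha>. \<alpha> \<in> tuples A n - rho \<Longrightarrow> \<exists>psi. vf_preserves A n psi rho \<and> apply_vf psi \<alpha> = \<beta>"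
    using assms(2) unfolding key_relation_def by blast
  obtain m f where f: "is_WNU A m f" and pres: "op_preserves n m f rho"
    using assms(3) unfolding preserved_by_WNU_def by blast
  define g where "g z = f (map z [0..<m])" for z
  have const: "map (\<lambda>_. v) [0..<m] = replicate m v" for v :: 'a
    by (simp add: map_replicate_const)
  have update: "map ((\<lambda>_. v)(i := w)) [0..<m] = (replicate m v)[i := w]" if "i < m" for v w :: 'a and i
    using map_upt_update[OF that, of "\<lambda>_. v" w] by (simp add: const)
  have "key_wnu A n m (\<lambda>x. map x [0..<n] \<in> rho) ((!) \<beta>) g"
  proof
    show "map t' [0..<n] \<in> rho" if "map t [0..<n] \<in> rho" "\<And>k. k < n \<Longrightarrow> t k = t' k" for t t'
    proof -
      have "map t [0..<n] = map t' [0..<n]" using that(2) by simp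
      then show ?thesis using that(1) by metis
    qed
    show "t k \<in> A" if "map t [0..<n] \<in> rho" "k < n" for t k
      using that rho map_upt_in_tuples[of t n A] by blast
    show "\<beta> ! k \<in> A" if "k < n" for k
      using \<beta> that tuples_nth by blast
    show "map ((!) \<beta>) [0..<n] \<notin> rho"
      using \<beta> tuples_map_nth[of \<beta> A n] by simp
    show "\<exists>\<psi>. (\<forall>k<n. \<forall>v\<in>A. \<psi> k v \<in> A) \<and>
        (\<forall>t. map t [0..<n] \<in> rho \<longrightarrow> map (\<lambda>k. \<psi> k (t k)) [0..<n] \<in> rho) \<and>
        (\<forall>k<n. \<psi> k (\<alpha> k) = \<beta> ! k)"
      if \<alpha>: "\<And>k. k < n \<Longrightarrow> \<alpha> k \<in> A" "map \<alpha> [0..<n] \<notin> rho" for \<alpha>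
    proof -
      have "map \<alpha> [0..<n] \<in> tuples A n - rho" using \<alpha> map_upt_in_tuples[of \<alpha> n A] by simp
      from key[OF this] obtain psi where psi: "vf_preserves A n psi rho" "apply_vf psi (map \<alpha> [0..<n]) = \<beta>"
        by blast
      have vf: "apply_vf psi (map t [0..<n]) = map (\<lambda>k. psi k (t k)) [0..<n]" for t
        by (simp add: apply_vf_def)
      have "\<forall>k<n. psi k (\<alpha> k) = \<beta> ! k" using psi(2) unfolding vf by auto
      moreover have "map (\<lambda>k. psi k (t k)) [0..<n] \<in> rho" if "map t [0..<n] \<in> rho" for t
        using psi(1) that vf[of t] by (metis vf_preserves_def)
      ultimately show ?thesis using psi(1) unfolding vf_preserves_def by blast
    qed
    show "2 \<le> m" using f by (simp add: is_WNU_def)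
    show "g z \<in> A" if "\<And>j. j < m \<Longrightarrow> z j \<in> A" for z
      using f that map_upt_in_tuples[of z m A] by (simp add: is_WNU_def g_def)
    show "g z = g z'" if "\<And>j. j < m \<Longrightarrow> z j = z' j" for z z'
      unfolding g_def by (rule arg_cong[of _ _ f]) (use that in simp)
    show "g (\<lambda>_. v) = v" if "v \<in> A" for v
      using f that by (simp add: is_WNU_def g_def const)
    show "g ((\<lambda>_. v)(i := w)) = g ((\<lambda>_. v)(j := w))" if "v \<in> A" "w \<in> A" "i < m" "j < m" for v w i j
      unfolding g_def update[OF that(3)] update[OF that(4)] using f that unfolding is_WNU_def by blast
    show "map (\<lambda>k. g (\<lambda>j. X j k)) [0..<n] \<in> rho" if "\<And>j. j < m \<Longrightarrow> map (X j) [0..<n] \<in> rho" for X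
    proof -
      define ts where "ts = map (\<lambda>j. map (X j) [0..<n]) [0..<m]"
      have "length ts = m" "set ts \<subseteq> rho" using that by (auto simp: ts_def)
      then have "apply_op n f ts \<in> rho" using pres by (simp add: op_preserves_def)
      moreover have "apply_op n f ts = map (\<lambda>k. g (\<lambda>j. X j k)) [0..<n]"
        by (auto simp: apply_op_def ts_def g_def intro!: arg_cong[of _ _ f])
      ultimately show ?thesis by simp
    qed
  qed
  then show ?thesis using that \<beta> by blast
qed

lemma cube_of_key_relation:
  assumes n: "3 \<le> n" and rho: "rho \<subseteq> tuples A n"
    and wnu: "preserved_by_WNU A n rho" and key: "key_relation A n rho"
    and pat: "\<forall>i<n. \<forall>j<n. pattern A n rho i j \<longleftrightarrow> (i = j \<or> (i < 2 \<and> j < 2))"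
  shows "\<exists>a \<in> tuples A n - rho. \<exists>b \<in> tuples A n. (\<forall>i<n. b ! i \<noteq> a ! i) \<and>
       {x \<in> tuples A n. \<forall>i<n. x ! i \<in> {a ! i, b ! i}}
         - {a, take 2 b @ drop 2 a} \<subseteq> rho"
proof -
  define R where "R x \<longleftrightarrow> map x [0..<n] \<in> rho" for x
  obtain a m g where a: "a \<in> tuples A n - rho"
    and "key_wnu A n m (\<lambda>x. map x [0..<n] \<in> rho) ((!) a) g"
    using key_wnu_of_key_relation[OF rho key wnu] by blast
  then interpret key_wnu A n m R "(!) a" g by (simp add: R_def[abs_def])
  have "pattern A n rho 0 1" "2 \<le> n" using pat n by auto
  then have rect: rectangular
    unfolding rectangular_def R_def using pattern_rectangle[OF rho] by blast
  have pair: "good {i, j}" if ij: "i < n" "j < n" "i \<noteq> j" "\<not> (i < 2 \<and> j < 2)" for i j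
  proof -
    have "\<not> pattern A n rho i j" using pat ij by blast
    then obtain c x y where c: "c \<in> tuples A n" "c \<notin> rho"
      "c[i := x] \<in> rho" "c[j := y] \<in> rho" "c[i := x, j := y] \<in> rho"
      unfolding pattern_def by blast
    have c': "map ((!) c) [0..<n] = c" using tuples_map_nth[OF c(1)] .
    have upd: "c[k := v] = map (((!) c)(k := v)) [0..<n]" if "k < n" for k v
      using map_upt_update[OF that, of "(!) c" v] c' by simp
    have upd2: "c[i := x, j := y] = map (((!) c)(i := x, j := y)) [0..<n]"
      using map_upt_update[OF ij(2), of "((!) c)(i := x)" y] upd[OF ij(1)] by simp
    show ?thesis
    proof (rule good_pair[OF ij(1-3)])
      show "c ! k \<in> A" if "k < n" for k using tuples_nth[OF c(1) that] .
      show "\<not> R ((!) c)" using c(2) by (simp add: R_def c')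
      show "R (((!) c)(i := x))" using c(3) unfolding R_def upd[OF ij(1)] .
      show "R (((!) c)(j := y))" using c(4) unfolding R_def upd[OF ij(2)] .
      show "R (((!) c)(i := x, j := y))" using c(5) unfolding R_def upd2 .
    qed
  qed
  \<comment> \<open>Omitting coordinate 0 or 1 leaves pairwise inequivalent coordinates.\<close>
  have face: "good ({..<n} - {i})" if "i < 2" for i
  proof (rule good_of_pairs)
    show "good {k, l}" if "k \<in> {..<n} - {i}" "l \<in> {..<n} - {i}" "k \<noteq> l" for k l
      using that \<open>i < 2\<close> by (intro pair) auto
    show "2 \<le> card ({..<n} - {i})" using n that by simp
  qed auto
  obtain b where b: "\<And>T. T \<subseteq> {..<n} \<Longrightarrow> T \<noteq> {} \<Longrightarrow> T \<noteq> {0, 1} \<Longrightarrow> R (sub T b)"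
    using cube_of_faces[OF n rect face[of 0] face[of 1]] by auto
  have single: "R (sub {i} b)" if "i < n" for i
    using that by (intro b) auto
  have b_A: "b i \<in> A" if "i < n" for i
    using R_A[OF single[OF that] that] by (simp add: sub_def)
  have b_neq: "b i \<noteq> a ! i" if "i < n" for i
  proof
    assume "b i = a ! i"
    then have "sub {i} b = (!) a" by (auto simp: sub_def)
    then show False using single[OF that] key_tuple_notin by simp
  qed
  have len: "length a = n" using a by (simp add: tuples_def)
  have "x \<in> rho" if x: "x \<in> tuples A n" "\<forall>i<n. x ! i \<in> {a ! i, map b [0..<n] ! i}"
    "x \<noteq> a" "x \<noteq> take 2 (map b [0..<n]) @ drop 2 a" for x
  proof -
    \<comment> \<open>This makes \<open>x\<close> the corner \<open>sub T b\<close>;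
      \<open>T = {}\<close> corresponds to \<open>a\<close>, and \<open>T = {0, 1}\<close> to the
      second exceptional corner.\<close>
    define T where "T = {i. i < n \<and> x ! i \<noteq> a ! i}"
    have lenx: "length x = n" using x(1) by (simp add: tuples_def)
    have nth: "x ! i = sub T b i" if "i < n" for i
      using x(2) that by (auto simp: T_def sub_def)
    have "R (sub T b)"
    proof (rule b)
      show "T \<subseteq> {..<n}" by (auto simp: T_def)
      show "T \<noteq> {}" using x(3) lenx len by (auto simp: T_def list_eq_iff_nth_eq)
      show "T \<noteq> {0, 1}"
      proof
        assume T: "T = {0, 1}"
        have "x = take 2 (map b [0..<n]) @ drop 2 a"
        proof (rule nth_equalityI)
          show "length x = length (take 2 (map b [0..<n]) @ drop 2 a)"
            using lenx len n by simp
          show "x ! i = (take 2 (map b [0..<n]) @ drop 2 a) ! i" if "i < length x" for i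
            using nth[of i] that lenx len n T by (auto simp: nth_append sub_def simp del: add_2_eq_Suc)
        qed
        then show False using x(4) by simp
      qed
    qed
    moreover have "map (sub T b) [0..<n] = x"
      using nth lenx by (auto simp: list_eq_iff_nth_eq)
    ultimately show ?thesis by (simp add: R_def)
  qed
  then have "{x \<in> tuples A n. \<forall>i<n. x ! i \<in> {a ! i, map b [0..<n] ! i}}
      - {a, take 2 (map b [0..<n]) @ drop 2 a} \<subseteq> rho"
    by blast
  moreover have "\<forall>i<n. map b [0..<n] ! i \<noteq> a ! i" using b_neq by simp
  moreover have "map b [0..<n] \<in> tuples A n" using b_A by (simp add: map_upt_in_tuples)
  ultimately show ?thesis using a by blast
qed

theorem mainTheorem9:
  fixes A :: "'a set" and n :: nat and rho :: "'a list set"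
  assumes "finite A" and "n \<ge> 3"
    and "rho \<subseteq> tuples A n"
    and "preserved_by_WNU A n rho"
    and "\<forall>i<n. \<forall>j<n. pattern A n rho i j \<longleftrightarrow> (i = j \<or> (i < 2 \<and> j < 2))"
  shows "key_relation A n rho \<longleftrightarrow>
    (\<exists>a \<in> tuples A n - rho. \<exists>b \<in> tuples A n. (\<forall>i<n. b ! i \<noteq> a ! i) \<and>
       {x \<in> tuples A n. \<forall>i<n. x ! i \<in> {a ! i, b ! i}}
         - {a, take 2 b @ drop 2 a} \<subseteq> rho)"
  (is "_ \<longleftrightarrow> ?cube")
proof
  assume "key_relation A n rho"
  then show ?cube by (rule cube_of_key_relation[OF assms(2-4) _ assms(5)])
next
  have pat: "pattern A n rho 0 1" using assms(2,5) by auto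
  assume ?cube
  then show "key_relation A n rho"
    by (elim bexE conjE) (rule key_relation_of_cube[OF assms(2,3) pat])
qed

end
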